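(* Let $d>1$ and let $(X,Y)$ be a continuous $d$-dimensional random variable, with $X$ taking values in $\mathbb{R}^{d-1}$ and $Y$ in $\mathbb{R}$, having elliptically contoured distribution $$\begin{pmatrix} X\\ Y\end{pmatrix}\sim \mathrm{EC}_d(\mu,\Sigma,\psi),\qquad \mu=\begin{pmatrix}\mu_x\\ \mu_y\end{pmatrix},\qquad \Sigma=\begin{pmatrix}\Sigma_{11}&\sigma_{12}\\ \sigma_{21}&\sigma_{22}\end{pmatrix},$$ and denote its density by $f_0(x,y)$. Put $$m_Y(x)=\mu_y+\sigma_{21}\Sigma_{11}^{-1}(x-\mu_x),\qquad \sigma_{22\cdot 1}=\sigma_{22}-\sigma_{21}\Sigma_{11}^{-1}\sigma_{12}.$$ Let $G_0$ be a continuous distribution function on $\mathbb{R}$ such that $G_0(-t)=1-G_0(t)$ for all $t\in\mathbb{R}$. Let $h:\mathbb{R}^{d-1}\to\mathbb{R}$ be any Borel measurable function and $w_0:\mathbb{R}\to\mathbb{R}$ any Borel measurable odd function, and let $w(x,y)$ be either of the two functions $$w(x,y)=w_0\big(y-m_Y(x)\big)\,h(x)\qquad\text{or}\qquad w(x,y)=w_0\!\left(\frac{y-m_Y(x)}{(\sigma_{22\cdot 1})^{1/2}}\right)h(x).$$ Then $$f(x,y)=2\,f_0(x,y)\,G_0\{w(x,y)\},\qquad (x,y)\in\mathbb{R}^{d-1}\times\mathbb{R},$$ is a proper probability density function on $\mathbb{R}^d$ (nonnegative, with integral $1$).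
   Context: A $d$-dimensional random variable $Z$ has the elliptically contoured distribution $\mathrm{EC}_d(\mu,\Sigma,\psi)$, with $\mu\in\mathbb{R}^d$, $\Sigma$ a symmetric positive definite $d\times d$ matrix and $\psi$ a scalar function (the generator), if its characteristic function is $t\mapsto e^{i t^\top\mu}\,\psi(t^\top\Sigma t)$. "Continuous" means that $Z$ has a density with respect to Lebesgue measure; this density is then of the form $z\mapsto |\Sigma|^{-1/2} g\big((z-\mu)^\top\Sigma^{-1}(z-\mu)\big)$ for some nonnegative function $g$. In the partition, $\mu_x\in\mathbb{R}^{d-1}$, $\mu_y\in\mathbb{R}$, $\Sigma_{11}$ is $(d-1)\times(d-1)$, $\sigma_{12}=\sigma_{21}^\top$ is $(d-1)\times 1$, and $\sigma_{22}\in\mathbb{R}$. A function $w_0$ is odd if $w_0(-u)=-w_0(u)$ for all $u$. *)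

theory Defs
  imports "HOL-Probability.Probability"
begin

definition positive_definite :: "real ^ 'd ^ 'd \<Rightarrow> bool" where
  "positive_definite S \<longleftrightarrow> (\<forall>v. v \<noteq> 0 \<longrightarrow> v \<bullet> (S *v v) > 0)"

definition char_fun :: "'a measure \<Rightarrow> ('a \<Rightarrow> real ^ 'd) \<Rightarrow> real ^ 'd \<Rightarrow> complex" where
  "char_fun M Z t = (CLINT \<omega>|M. iexp (t \<bullet> Z \<omega>))"

text \<open>
  The generator may take complex values; it matters only at arguments of the form
  \<open>t \<bullet> (S *v t)\<close>, where the symmetry \<open>t \<mapsto> -t\<close> forces it to be real.
\<close>

definition elliptically_contoured ::
  "'a measure \<Rightarrow> ('a \<Rightarrow> real ^ 'd) \<Rightarrow> real ^ 'd \<Rightarrow> real ^ 'd ^ 'd \<Rightarrow> (real \<Rightarrow> complex) \<Rightarrow> bool" where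
  "elliptically_contoured M Z m S \<psi> \<longleftrightarrow>
     Z \<in> borel_measurable M \<and> transpose S = S \<and> positive_definite S \<and>
     (\<forall>t. char_fun M Z t = iexp (t \<bullet> m) * \<psi> (t \<bullet> (S *v t)))"

text \<open>
  Vectors with \<open>d = CARD('n) + 1 > 1\<close> coordinates are indexed by \<^typ>\<open>'n option\<close>: the indices
  \<open>Some i\<close> are the first \<open>d - 1\<close> coordinates and \<open>None\<close> is the last one. In \<open>block_matrix\<close>,
  the column \<open>s12\<close> and the row \<open>s21\<close> are both given as vectors.
\<close>

definition block_vec :: "real ^ 'n \<Rightarrow> real \<Rightarrow> real ^ 'n option" where
  "block_vec x y = (\<chi> i. case i of Some k \<Rightarrow> x $ k | None \<Rightarrow> y)"

definition block_matrix ::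
  "real ^ 'n ^ 'n \<Rightarrow> real ^ 'n \<Rightarrow> real ^ 'n \<Rightarrow> real \<Rightarrow> real ^ 'n option ^ 'n option" where
  "block_matrix S11 s12 s21 s22 =
     (\<chi> i j. case i of
        Some k \<Rightarrow> (case j of Some l \<Rightarrow> S11 $ k $ l | None \<Rightarrow> s12 $ k)
      | None \<Rightarrow> (case j of Some l \<Rightarrow> s21 $ l | None \<Rightarrow> s22))"

lemma block_vec_exhaust: "\<exists>x y. z = block_vec x y"
proof (intro exI)
  show "z = block_vec (\<chi> k. z $ Some k) (z $ None)"
    by (simp add: block_vec_def vec_eq_iff split: option.split)
qed

lemma block_matrix_mult_block_vec:
  "block_matrix S11 s12 s21 s22 *v block_vec x y =
     block_vec (S11 *v x + y *\<^sub>R s12) (s21 \<bullet> x + s22 * y)"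
  by (simp add: vec_eq_iff matrix_vector_mult_def block_matrix_def block_vec_def UNIV_option_conv
      sum.reindex inner_vec_def split: option.split)

end

theory Submission
  imports Defs
begin

text \<open>
  The reflection \<open>R (x, y) = (x, 2 m\<^sub>Y x - y)\<close> is affine, fixes the centre and preserves the quadratic
  form of \<open>\<Sigma>\<close>, so \<open>(X, Y)\<close> and \<open>R (X, Y)\<close> have the same characteristic function and hence the same
  law. Since \<open>w\<^sub>0\<close> is odd, \<open>w\<close> changes sign under \<open>R\<close>, so \<open>E (G\<^sub>0 (w (X, Y))) = E (1 - G\<^sub>0 (w (X, Y)))\<close>
  and this expectation is \<open>1 / 2\<close>.

  Uniqueness of multivariate characteristic functions: they determine the integrals of trigonometric
  polynomials, hence by Stone--Weierstrass those of \<open>f (L sin (x\<^sub>1 / L), \<dots>, L sin (x\<^sub>d / L))\<close> for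
  bounded continuous \<open>f\<close>, and these converge to the integral of \<open>f\<close> as \<open>L \<rightarrow> \<infinity>\<close>.
\<close>

section \<open>Trigonometric polynomials and their integrals\<close>

text \<open>The phase \<open>c\<close> lets a single kind of atom cover constants (zero frequency)
  and sines (phase \<open>- (pi / 2)\<close>), so closure under products has to be checked on
  cosines only.\<close>

inductive_set trig_polys :: "('a::real_inner \<Rightarrow> real) set" where
  trig_polys_cos: "(\<lambda>x. a * cos (t \<bullet> x + c)) \<in> trig_polys"
| trig_polys_add: "p \<in> trig_polys \<Longrightarrow> q \<in> trig_polys \<Longrightarrow> (\<lambda>x. p x + q x) \<in> trig_polys"

lemma trig_polys_const: "(\<lambda>x. a) \<in> trig_polys"
  using trig_polys_cos[of a 0 0] by simp

lemma trig_polys_sin: "(\<lambda>x. a * sin (t \<bullet> x)) \<in> trig_polys"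
  using trig_polys_cos[of a t "- (pi / 2)"] by (simp add: cos_diff)

lemma trig_polys_sum:
  "finite I \<Longrightarrow> (\<And>i. i \<in> I \<Longrightarrow> p i \<in> trig_polys) \<Longrightarrow> (\<lambda>x. \<Sum>i\<in>I. p i x) \<in> trig_polys"
  by (induction I rule: finite_induct) (auto intro: trig_polys_add trig_polys_const)

text \<open>Product-to-sum formula: 2 cos u cos v = cos (u - v) + cos (u + v), so frequencies and
  phases are subtracted and added.\<close>

lemma trig_polys_mult_cos:
  assumes "p \<in> trig_polys"
  shows "(\<lambda>x. p x * (a * cos (t \<bullet> x + c))) \<in> trig_polys"
  using assms
proof induction
  case (trig_polys_cos b s d)
  have "b * cos (s \<bullet> x + d) * (a * cos (t \<bullet> x + c)) =
      (a * b / 2) * cos ((s - t) \<bullet> x + (d - c)) + (a * b / 2) * cos ((s + t) \<bullet> x + (d + c))" for x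
  proof -
    have "(s - t) \<bullet> x + (d - c) = (s \<bullet> x + d) - (t \<bullet> x + c)"
        "(s + t) \<bullet> x + (d + c) = (s \<bullet> x + d) + (t \<bullet> x + c)"
      by (simp_all add: inner_left_distrib inner_diff_left)
    then show ?thesis by (simp only: cos_add cos_diff) (simp add: field_simps)
  qed
  then show ?case
    by (simp only: trig_polys.trig_polys_add trig_polys.trig_polys_cos)
next
  case (trig_polys_add p q)
  then show ?case by (simp add: distrib_right trig_polys.trig_polys_add)
qed

lemma trig_polys_mult:
  assumes "p \<in> trig_polys" "q \<in> trig_polys"
  shows "(\<lambda>x. p x * q x) \<in> trig_polys"
  using assms(2)
proof induction
  case (trig_polys_cos a t c)
  then show ?case using trig_polys_mult_cos[OF assms(1)] .
next
  case (trig_polys_add q r)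
  then show ?case by (simp add: distrib_left trig_polys.trig_polys_add)
qed

text \<open>An atom is \<open>a\<close> times the real part of
  \<open>iexp c * iexp (t \<bullet> x)\<close>, so its integral is determined by the characteristic
  function at \<open>t\<close>. Integrability is part of the conclusion because the step for sums
  splits the integral.\<close>

lemma integral_trig_polys_eq:
  fixes P Q :: "'a::euclidean_space measure"
  assumes P: "prob_space P" "sets P = sets borel" and Q: "prob_space Q" "sets Q = sets borel"
    and char_eq: "\<And>t. (CLINT x|P. iexp (t \<bullet> x)) = (CLINT x|Q. iexp (t \<bullet> x))"
    and "p \<in> trig_polys"
  shows "integrable P p \<and> integrable Q p \<and> integral\<^sup>L P p = integral\<^sup>L Q p"
  using \<open>p \<in> trig_polys\<close>
proof induction
  case (trig_polys_cos a t c)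
  have *: "integrable D (\<lambda>x. a * cos (t \<bullet> x + c))"
      "(\<integral>x. a * cos (t \<bullet> x + c) \<partial>D) = a * Re (iexp c * (CLINT x|D. iexp (t \<bullet> x)))"
    if "prob_space D" "sets D = sets borel" for D :: "'a measure"
  proof -
    interpret prob_space D by fact
    note [measurable_cong] = that(2)
    have int: "integrable D (\<lambda>x. iexp (t \<bullet> x))"
      by (rule integrable_const_bound[where B = 1]) auto
    have eq: "Re (iexp c * iexp (t \<bullet> x)) = cos (t \<bullet> x + c)" for x
      by (simp add: exp_add[symmetric] Re_exp algebra_simps)
    have "integrable D (\<lambda>x. cos (t \<bullet> x + c))"
      by (rule integrable_const_bound[where B = 1]) auto
    then show "integrable D (\<lambda>x. a * cos (t \<bullet> x + c))" by simp
    have "(\<integral>x. cos (t \<bullet> x + c) \<partial>D) = Re (CLINT x|D. iexp c * iexp (t \<bullet> x))"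
      unfolding eq[symmetric] using int by (intro integral_Re integrable_mult_right) auto
    then show "(\<integral>x. a * cos (t \<bullet> x + c) \<partial>D) = a * Re (iexp c * (CLINT x|D. iexp (t \<bullet> x)))"
      by simp
  qed
  show ?case by (simp only: *[OF P] *[OF Q] char_eq simp_thms)
next
  case (trig_polys_add p q)
  then show ?case by simp
qed

section \<open>Uniqueness of characteristic functions\<close>

text \<open>A smooth substitute for truncation: it has bounded range, its coordinates are
  trigonometric polynomials, and it tends pointwise to the identity as \<open>L\<close>
  grows.\<close>

definition sin_cut :: "real \<Rightarrow> 'a::euclidean_space \<Rightarrow> 'a" where
  "sin_cut L x = (\<Sum>b\<in>Basis. (L * sin (x \<bullet> b / L)) *\<^sub>R b)"

text \<open>A linear \<open>p\<close> turns the sum over the basis into a sum of sines with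
  frequencies \<open>b /\<^sub>R L\<close>; closure under sums and products does the rest.\<close>

lemma trig_polys_polynomial_sin_cut:
  fixes p :: "'a::euclidean_space \<Rightarrow> real"
  assumes "real_polynomial_function p"
  shows "(\<lambda>x. p (sin_cut L x)) \<in> trig_polys"
  using assms
proof induction
  case (linear p)
  interpret bounded_linear p by fact
  have "p (sin_cut L x) = (\<Sum>b\<in>Basis. (L * p b) * sin ((b /\<^sub>R L) \<bullet> x))" for x
    unfolding sin_cut_def
    by (simp add: sum scaleR divide_inverse inner_commute mult_ac)
  then show ?case by (simp add: trig_polys_sum trig_polys_sin del: inner_scaleR_left)
qed (auto intro: trig_polys_const trig_polys_add trig_polys_mult)

lemma continuous_on_sin_cut: "continuous_on UNIV (sin_cut L)"
  unfolding sin_cut_def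
  \<comment> \<open>The continuity rule for division requires \<open>L \<noteq> 0\<close>; for
    \<open>L = 0\<close> the map is constantly zero.\<close>
  by (cases "L = 0") (auto intro!: continuous_intros)

lemma norm_sin_cut_le:
  assumes "L \<ge> 0"
  shows "norm (sin_cut L (x::'a::euclidean_space)) \<le> L * DIM('a)"
proof -
  have "norm (sin_cut L x) \<le> (\<Sum>b\<in>(Basis::'a set). L)"
    unfolding sin_cut_def
    by (rule sum_norm_le) (use assms in \<open>simp add: abs_mult mult_left_le\<close>)
  then show ?thesis by (simp add: mult.commute)
qed

lemma sin_cut_tendsto: "(\<lambda>n. sin_cut (real (Suc n)) x) \<longlonglongrightarrow> x"
proof -
  have "(\<lambda>n. real (Suc n) * sin (c / real (Suc n))) \<longlonglongrightarrow> c" for c :: real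
    by real_asymp
  then have "(\<lambda>n. sin_cut (real (Suc n)) x) \<longlonglongrightarrow> (\<Sum>b\<in>Basis. (x \<bullet> b) *\<^sub>R b)"
    unfolding sin_cut_def by (intro tendsto_intros)
  then show ?thesis by (simp add: euclidean_representation)
qed

text \<open>The range of \<open>sin_cut L\<close> lies in a compact ball, on which Stone-Weierstrass
  approximates \<open>f\<close> uniformly by a polynomial. Composed with \<open>sin_cut L\<close>,
  that polynomial has the same integral under \<open>P\<close> and \<open>Q\<close>.\<close>

lemma integral_sin_cut_eq:
  fixes P Q :: "'a::euclidean_space measure" and f :: "'a \<Rightarrow> real"
  assumes P: "prob_space P" "sets P = sets borel" and Q: "prob_space Q" "sets Q = sets borel"
    and char_eq: "\<And>t. (CLINT x|P. iexp (t \<bullet> x)) = (CLINT x|Q. iexp (t \<bullet> x))"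
    and f: "continuous_on UNIV f" and bdd: "\<And>x. \<bar>f x\<bar> \<le> B" and "L \<ge> 0"
  shows "(\<integral>x. f (sin_cut L x) \<partial>P) = (\<integral>x. f (sin_cut L x) \<partial>Q)"
proof -
  \<comment> \<open>Here \<open>r\<close> is the common integral of the approximating trigonometric
    polynomial.\<close>
  have near: "\<exists>r. \<bar>(\<integral>x. f (sin_cut L x) \<partial>P) - r\<bar> \<le> e \<and> \<bar>(\<integral>x. f (sin_cut L x) \<partial>Q) - r\<bar> \<le> e"
    if "e > 0" for e
  proof -
    obtain p where p: "real_polynomial_function p"
      and close: "\<And>x. x \<in> cball 0 (L * DIM('a)) \<Longrightarrow> \<bar>f x - p x\<bar> < e"
      using Stone_Weierstrass_real_polynomial_function[OF compact_cball
          continuous_on_subset[OF f subset_UNIV] \<open>e > 0\<close>] by blast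
    note tp = integral_trig_polys_eq[OF P Q char_eq trig_polys_polynomial_sin_cut[OF p, of L]]
    have "\<bar>(\<integral>x. f (sin_cut L x) \<partial>D) - (\<integral>x. p (sin_cut L x) \<partial>D)\<bar> \<le> e"
      if D: "prob_space D" "sets D = sets borel" and int: "integrable D (\<lambda>x. p (sin_cut L x))"
      for D :: "'a measure"
    proof -
      interpret prob_space D by fact
      note [measurable_cong] = D(2)
      have [measurable]: "(\<lambda>x. f (sin_cut L x)) \<in> borel_measurable borel"
        using continuous_on_compose2[OF f continuous_on_sin_cut subset_UNIV]
        by (rule borel_measurable_continuous_onI)
      have intf: "integrable D (\<lambda>x. f (sin_cut L x))"
        by (rule integrable_const_bound[where B = B]) (auto simp: bdd)
      have "\<bar>\<integral>x. f (sin_cut L x) - p (sin_cut L x) \<partial>D\<bar> \<le> (\<integral>x. \<bar>f (sin_cut L x) - p (sin_cut L x)\<bar> \<partial>D)"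
        by (rule integral_abs_bound)
      also have "\<dots> \<le> (\<integral>x. e \<partial>D)"
        using intf int norm_sin_cut_le[OF \<open>L \<ge> 0\<close>]
        by (intro integral_mono integrable_abs less_imp_le[OF close]) auto
      finally show ?thesis using intf int by (simp add: prob_space)
    qed
    then show ?thesis using tp P Q by metis
  qed
  \<comment> \<open>The summand 0 gives the bound the shape that \<open>field_le_epsilon\<close>
    expects.\<close>
  have "\<bar>(\<integral>x. f (sin_cut L x) \<partial>P) - (\<integral>x. f (sin_cut L x) \<partial>Q)\<bar> \<le> 0 + e" if "e > 0" for e
    proof -
    obtain r where "\<bar>(\<integral>x. f (sin_cut L x) \<partial>P) - r\<bar> \<le> e / 2" "\<bar>(\<integral>x. f (sin_cut L x) \<partial>Q) - r\<bar> \<le> e / 2"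
      using near[of "e / 2"] \<open>e > 0\<close> by auto
    then show ?thesis by linarith
  qed
  then have "\<bar>(\<integral>x. f (sin_cut L x) \<partial>P) - (\<integral>x. f (sin_cut L x) \<partial>Q)\<bar> \<le> 0"
    by (rule field_le_epsilon)
  then show ?thesis by simp
qed

text \<open>Dominated convergence along L = n + 1, with the constant \<open>B\<close> as dominating
  function.\<close>

lemma integral_bounded_continuous_eq:
  fixes P Q :: "'a::euclidean_space measure" and f :: "'a \<Rightarrow> real"
  assumes P: "prob_space P" "sets P = sets borel" and Q: "prob_space Q" "sets Q = sets borel"
    and char_eq: "\<And>t. (CLINT x|P. iexp (t \<bullet> x)) = (CLINT x|Q. iexp (t \<bullet> x))"
    and f: "continuous_on UNIV f" and bdd: "\<And>x. \<bar>f x\<bar> \<le> B"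
  shows "integral\<^sup>L P f = integral\<^sup>L Q f"
proof -
  have lim: "(\<lambda>n. \<integral>x. f (sin_cut (real (Suc n)) x) \<partial>D) \<longlonglongrightarrow> integral\<^sup>L D f"
    if D: "prob_space D" "sets D = sets borel" for D :: "'a measure"
  proof -
    interpret prob_space D by fact
    note [measurable_cong] = D(2)
    have [measurable]: "f \<in> borel_measurable borel"
      "(\<lambda>x. f (sin_cut (real (Suc n)) x)) \<in> borel_measurable borel" for n
      using f continuous_on_compose2[OF f continuous_on_sin_cut subset_UNIV]
      by (auto intro: borel_measurable_continuous_onI)
    have "(\<lambda>n. f (sin_cut (real (Suc n)) x)) \<longlonglongrightarrow> f x" for x
      using f sin_cut_tendsto[of x]
      by (metis UNIV_I continuous_on_tendsto_compose eventually_sequentiallyI)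
    then show ?thesis
      by (intro integral_dominated_convergence[where w = "\<lambda>_. B"]) (auto simp: bdd simp del: of_nat_Suc)
  qed
  show ?thesis
    using lim[OF P] lim[OF Q] integral_sin_cut_eq[OF P Q char_eq f bdd] LIMSEQ_unique by simp
qed

text \<open>Closed sets form an intersection-stable generator of the Borel sets, and the indicator
  of a closed set is a pointwise limit of bounded continuous functions.\<close>

lemma char_fun_uniqueness:
  fixes P Q :: "'a::euclidean_space measure"
  assumes P: "prob_space P" "sets P = sets borel" and Q: "prob_space Q" "sets Q = sets borel"
    and char_eq: "\<And>t. (CLINT x|P. iexp (t \<bullet> x)) = (CLINT x|Q. iexp (t \<bullet> x))"
  shows "P = Q"
proof (rule measure_eqI_generator_eq[where E = "Collect closed" and \<Omega> = UNIV and A = "\<lambda>_. UNIV"])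
  show "Int_stable (Collect closed :: 'a set set)" by (auto simp: Int_stable_def)
  show "sets P = sigma_sets UNIV (Collect closed)" "sets Q = sigma_sets UNIV (Collect closed)"
    using P Q by (simp_all add: borel_eq_closed)
  interpret P: prob_space P by fact
  interpret Q: prob_space Q by fact
  show "emeasure P UNIV \<noteq> \<infinity>" by simp
  fix C :: "'a set" assume "C \<in> Collect closed"
  then have C: "closed C" by simp
  show "emeasure P C = emeasure Q C"
  \<comment> \<open>The empty set is treated apart: \<open>infdist x {}\<close> is 0 by convention,
    which would make every \<open>g n\<close> constantly 1.\<close>
  proof (cases "C = {}")
    case False
    \<comment> \<open>\<open>g n\<close> equals 1 on \<open>C\<close> and, for n > 0, vanishes at
      distance at least 1/n from it.\<close>
    define g :: "nat \<Rightarrow> 'a \<Rightarrow> real" where "g n x = max 0 (1 - real n * infdist x C)" for n x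
    have cont: "continuous_on UNIV (g n)" for n
      unfolding g_def by (intro continuous_intros)
    have bdd: "\<bar>g n x\<bar> \<le> 1" for n x
      by (simp add: g_def infdist_nonneg)
    have ptw: "(\<lambda>n. g n x) \<longlonglongrightarrow> indicator C x" for x
    proof (cases "x \<in> C")
      case True
      then show ?thesis by (simp add: g_def)
    next
      case x: False
      then have pos: "infdist x C > 0"
        using C False by (metis in_closed_iff_infdist_zero infdist_nonneg less_eq_real_def)
      have "\<forall>\<^sub>F n in sequentially. g n x = 0"
        using eventually_ge_at_top[of "nat \<lceil>1 / infdist x C\<rceil>"]
      proof eventually_elim
        case (elim n)
        then have "1 / infdist x C \<le> real n" by linarith
        then show ?case using pos by (simp add: g_def field_simps)
      qed
      then show ?thesis using x by (simp add: tendsto_eventually)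
    qed
    have lim: "(\<lambda>n. integral\<^sup>L D (g n)) \<longlonglongrightarrow> measure D C"
      if D: "prob_space D" "sets D = sets borel" for D :: "'a measure"
    proof -
      interpret prob_space D by fact
      note [measurable_cong] = D(2)
      have [measurable]: "g n \<in> borel_measurable borel" for n
        using cont by (rule borel_measurable_continuous_onI)
      have [measurable]: "C \<in> sets borel" using C by simp
      have "(\<lambda>n. integral\<^sup>L D (g n)) \<longlonglongrightarrow> (\<integral>x. indicator C x \<partial>D)"
        using ptw by (intro integral_dominated_convergence[where w = "\<lambda>_. 1"]) (auto intro!: bdd)
      then show ?thesis using C by (simp add: D(2) sets_eq_imp_space_eq[OF D(2)])
    qed
    have "measure P C = measure Q C"
      using lim[OF P] lim[OF Q] integral_bounded_continuous_eq[OF P Q char_eq cont bdd]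
      by (simp add: LIMSEQ_unique)
    then show ?thesis by (simp add: P.emeasure_eq_measure Q.emeasure_eq_measure)
  qed simp
qed auto

section \<open>Block vectors, block matrices and positive definiteness\<close>

lemma transpose_block_matrix:
  "transpose (block_matrix A b c e) = block_matrix (transpose A) c b e"
  by (simp add: block_matrix_def transpose_def vec_eq_iff split: option.split)

lemma block_matrix_eq_iff:
  "block_matrix A b c e = block_matrix A' b' c' e' \<longleftrightarrow> A = A' \<and> b = b' \<and> c = c' \<and> e = e'"
  by (auto simp: block_matrix_def vec_eq_iff split_option_all split: option.splits)

lemma inner_block_vec: "block_vec x y \<bullet> block_vec x' y' = x \<bullet> x' + y * y'"
  by (simp add: inner_vec_def block_vec_def UNIV_option_conv sum.reindex)

text \<open>On vectors with last coordinate 0 the quadratic form of the block matrix is that of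
  \<open>A\<close>.\<close>

lemma positive_definite_block:
  assumes "positive_definite (block_matrix A b c e)"
  shows "positive_definite A"
  unfolding positive_definite_def
proof (intro allI impI)
  fix v :: "real ^ 'a" assume "v \<noteq> 0"
  then have "block_vec v 0 \<noteq> 0"
    by (auto simp: block_vec_def vec_eq_iff split_option_all)
  with assms show "v \<bullet> (A *v v) > 0"
    by (force simp: positive_definite_def block_matrix_mult_block_vec inner_block_vec)
qed

text \<open>The kernel is trivial: \<open>A *v v = 0\<close> gives
  \<open>v \<bullet> (A *v v) = 0\<close>, hence \<open>v = 0\<close>.\<close>

lemma positive_definite_invertible:
  assumes "positive_definite A"
  shows "invertible A"
  unfolding invertible_left_inverse matrix_left_invertible_ker
  using assms by (metis inner_zero_right less_irrefl positive_definite_def)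

lemma matrix_inv_mult_vec:
  fixes A :: "real ^ 'n ^ 'n"
  assumes "invertible A"
  shows "A *v (matrix_inv A *v v) = v"
proof -
  have "A ** matrix_inv A = mat 1"
    using assms someI_ex[of "\<lambda>B. A ** B = mat 1 \<and> B ** A = mat 1"]
    by (simp add: invertible_def matrix_inv_def)
  then show ?thesis by (simp add: matrix_vector_mul_assoc)
qed

lemma inner_matrix_symmetric:
  fixes A :: "real ^ 'n ^ 'n"
  assumes "transpose A = A"
  shows "(A *v u) \<bullet> v = u \<bullet> (A *v v)"
  by (metis assms dot_lmul_matrix transpose_matrix_vector)

definition block_fst :: "real ^ 'n option \<Rightarrow> real ^ 'n" where
  "block_fst z = (\<chi> k. z $ Some k)"

lemma block_fst_block_vec [simp]: "block_fst (block_vec x y) = x"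
  by (simp add: block_fst_def block_vec_def vec_eq_iff)

lemma block_vec_nth_None [simp]: "block_vec x y $ None = y"
  by (simp add: block_vec_def)

lemma block_vec_collapse [simp]: "block_vec (block_fst z) (z $ None) = z"
  by (simp add: block_fst_def block_vec_def vec_eq_iff split: option.split)

lemma continuous_on_block_fst: "continuous_on UNIV block_fst"
  unfolding block_fst_def by (intro continuous_intros)

lemma continuous_on_block_vec:
  assumes "continuous_on A f" "continuous_on A g"
  shows "continuous_on A (\<lambda>z. block_vec (f z) (g z))"
  unfolding block_vec_def
proof (intro continuous_on_vec_lambda)
  show "continuous_on A (\<lambda>z. case i of None \<Rightarrow> g z | Some k \<Rightarrow> f z $ k)" for i
    using assms by (cases i) (auto intro!: continuous_intros)
qed

section \<open>Invariance of the law under the reflection\<close>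

definition block_reflect :: "(real ^ 'n \<Rightarrow> real) \<Rightarrow> real ^ 'n option \<Rightarrow> real ^ 'n option" where
  "block_reflect m z = block_vec (block_fst z) (2 * m (block_fst z) - z $ None)"

lemma borel_measurable_block_reflect:
  assumes "continuous_on UNIV m"
  shows "block_reflect m \<in> borel_measurable borel"
  unfolding block_reflect_def
  by (intro borel_measurable_continuous_onI continuous_on_block_vec continuous_intros
      continuous_on_block_fst continuous_on_compose2[OF assms continuous_on_block_fst]) auto

text \<open>Let T be the linear part of the reflection. Then the left side is, up to a phase, the
  characteristic function at the transpose of T applied to \<open>t\<close>. The phase accounts for
  the fixed centre, and T times the block matrix times the transpose of T is the block matrix
  again.\<close>

lemma char_fun_block_reflect:
  fixes X :: "'a \<Rightarrow> real ^ 'n"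
  assumes ell: "elliptically_contoured M (\<lambda>\<omega>. block_vec (X \<omega>) (Y \<omega>))
        (block_vec mx my) (block_matrix A b c e) \<psi>"
    and m: "\<And>x. m x = my + c \<bullet> (matrix_inv A *v (x - mx))"
  shows "char_fun M (\<lambda>\<omega>. block_reflect m (block_vec (X \<omega>) (Y \<omega>))) t =
    char_fun M (\<lambda>\<omega>. block_vec (X \<omega>) (Y \<omega>)) t"
proof -
  have char: "char_fun M (\<lambda>\<omega>. block_vec (X \<omega>) (Y \<omega>)) u =
      iexp (u \<bullet> block_vec mx my) * \<psi> (u \<bullet> (block_matrix A b c e *v u))" for u
    using ell unfolding elliptically_contoured_def by (elim conjE) (erule spec)
  have pd_block: "positive_definite (block_matrix A b c e)"
    using ell unfolding elliptically_contoured_def by (elim conjE)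
  have "transpose (block_matrix A b c e) = block_matrix A b c e"
    using ell unfolding elliptically_contoured_def by (elim conjE)
  then have sym: "transpose A = A" and "c = b"
    unfolding transpose_block_matrix block_matrix_eq_iff by blast+
  have pd: "positive_definite A"
    using pd_block by (rule positive_definite_block)
  \<comment> \<open>The vector of regression coefficients; by symmetry of \<open>A\<close> it is the
    slope of the affine function \<open>m\<close>.\<close>
  define \<beta> where "\<beta> = matrix_inv A *v b"
  have A\<beta>: "A *v \<beta> = b"
    by (simp add: \<beta>_def matrix_inv_mult_vec positive_definite_invertible[OF pd])
  have m_eq: "m x = my + \<beta> \<bullet> (x - mx)" for x
    using inner_matrix_symmetric[OF sym, of \<beta> "matrix_inv A *v (x - mx)"]
    by (simp add: m \<open>c = b\<close> A\<beta> matrix_inv_mult_vec positive_definite_invertible[OF pd])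
  obtain tx ty where t: "t = block_vec tx ty"
    using block_vec_exhaust by blast
  \<comment> \<open>Expanding \<open>tx \<bullet> x + ty * (2 * m x - y)\<close>, the coefficients
    of \<open>x\<close> and \<open>y\<close> form \<open>s\<close>, and the constant term is
    \<open>k\<close>.\<close>
  define s where "s = block_vec (tx + (2 * ty) *\<^sub>R \<beta>) (- ty)"
  define k where "k = 2 * ty * (my - \<beta> \<bullet> mx)"
  have "t \<bullet> block_reflect m (block_vec x y) = k + s \<bullet> block_vec x y" for x y
    by (simp add: t s_def k_def block_reflect_def inner_block_vec m_eq inner_left_distrib
        inner_diff_right algebra_simps)
  then have "char_fun M (\<lambda>\<omega>. block_reflect m (block_vec (X \<omega>) (Y \<omega>))) t =
      iexp k * char_fun M (\<lambda>\<omega>. block_vec (X \<omega>) (Y \<omega>)) s"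
    by (simp add: char_fun_def distrib_left exp_add)
  also have "\<dots> = iexp (k + s \<bullet> block_vec mx my) * \<psi> (s \<bullet> (block_matrix A b c e *v s))"
    by (simp add: char distrib_left exp_add)
  \<comment> \<open>The reflection fixes the centre, since \<open>m mx = my\<close>.\<close>
  also have "k + s \<bullet> block_vec mx my = t \<bullet> block_vec mx my"
    by (simp add: t s_def k_def inner_block_vec inner_left_distrib algebra_simps)
  \<comment> \<open>The terms 4 ty^2 (\<beta> \<bullet> b) cancel, and the cross terms 4 ty (b
    \<bullet> tx) - 2 ty (b \<bullet> tx) leave the 2 ty (b \<bullet> tx) of the form at
    \<open>t\<close>.\<close>
  also have "s \<bullet> (block_matrix A b c e *v s) = t \<bullet> (block_matrix A b c e *v t)"
  proof -
    have "\<beta> \<bullet> (A *v tx) = b \<bullet> tx"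
      using inner_matrix_symmetric[OF sym, of \<beta> tx] by (simp add: A\<beta>)
    then show ?thesis
      by (simp add: t s_def block_matrix_mult_block_vec inner_block_vec \<open>c = b\<close> A\<beta>
          matrix_vector_right_distrib matrix_vector_mult_scaleR inner_left_distrib
          inner_right_distrib inner_commute algebra_simps)
  qed
  finally show ?thesis by (simp add: char)
qed

lemma distr_block_reflect:
  fixes X :: "'a \<Rightarrow> real ^ 'n"
  assumes "prob_space M"
    and ell: "elliptically_contoured M (\<lambda>\<omega>. block_vec (X \<omega>) (Y \<omega>))
        (block_vec mx my) (block_matrix A b c e) \<psi>"
    and m: "\<And>x. m x = my + c \<bullet> (matrix_inv A *v (x - mx))"
    and cont: "continuous_on UNIV m"
  shows "distr (distr M borel (\<lambda>\<omega>. block_vec (X \<omega>) (Y \<omega>))) borel (block_reflect m) =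
    distr M borel (\<lambda>\<omega>. block_vec (X \<omega>) (Y \<omega>))"
proof -
  interpret prob_space M by fact
  let ?Z = "\<lambda>\<omega>. block_vec (X \<omega>) (Y \<omega>)"
  have [measurable]: "?Z \<in> borel_measurable M"
    using ell by (simp add: elliptically_contoured_def)
  have [measurable]: "block_reflect m \<in> borel_measurable borel"
    using cont by (rule borel_measurable_block_reflect)
  have "(CLINT z|distr M borel (\<lambda>\<omega>. block_reflect m (?Z \<omega>)). iexp (t \<bullet> z)) =
      (CLINT z|distr M borel ?Z. iexp (t \<bullet> z))" for t
    using char_fun_block_reflect[OF ell m, of t] by (simp add: char_fun_def integral_distr)
  then have "distr M borel (\<lambda>\<omega>. block_reflect m (?Z \<omega>)) = distr M borel ?Z"
    by (intro char_fun_uniqueness prob_space_distr) simp_all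
  then show ?thesis by (simp add: distr_distr comp_def)
qed

section \<open>Mean of the skewing factor and the skewed density\<close>

text \<open>Substituting \<open>R\<close> leaves the integral I unchanged and turns its integrand
  into 1 minus itself, so I = 1 - I. Integrability comes first because the difference is integrated
  termwise.\<close>

lemma integral_skewing_factor:
  assumes "prob_space P" and [measurable]: "R \<in> measurable P P" "v \<in> borel_measurable P"
    and inv: "distr P P R = P"
    and odd: "\<And>z. v (R z) = - v z"
    and "real_distribution N" and sym: "\<And>t. cdf N (- t) = 1 - cdf N t"
  shows "integrable P (\<lambda>z. cdf N (v z))" and "(\<integral>z. cdf N (v z) \<partial>P) = 1 / 2"
proof -
  interpret P: prob_space P by fact
  interpret N: real_distribution N by fact
  have [measurable]: "cdf N \<in> borel_measurable borel"
    by (intro borel_measurable_mono monoI N.cdf_nondecreasing)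
  show int: "integrable P (\<lambda>z. cdf N (v z))"
    by (rule P.integrable_const_bound[where B = 1]) (auto simp: N.cdf_nonneg N.cdf_bounded_prob)
  have "(\<integral>z. cdf N (v z) \<partial>P) = (\<integral>z. cdf N (v z) \<partial>distr P P R)"
    by (simp add: inv)
  also have "\<dots> = (\<integral>z. 1 - cdf N (v z) \<partial>P)"
    by (simp add: integral_distr odd sym)
  also have "\<dots> = 1 - (\<integral>z. cdf N (v z) \<partial>P)"
    using int by (simp add: P.prob_space)
  finally show "(\<integral>z. cdf N (v z) \<partial>P) = 1 / 2" by simp
qed

theorem proposition3:
  fixes M :: "'a measure"
    and X :: "'a \<Rightarrow> real ^ 'n" and Y :: "'a \<Rightarrow> real"
    and \<mu>\<^sub>x :: "real ^ 'n" and \<mu>\<^sub>y :: real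
    and \<Sigma>\<^sub>1\<^sub>1 :: "real ^ 'n ^ 'n" and \<sigma>\<^sub>1\<^sub>2 \<sigma>\<^sub>2\<^sub>1 :: "real ^ 'n" and \<sigma>\<^sub>2\<^sub>2 :: real
    and \<psi> :: "real \<Rightarrow> complex"
    and f\<^sub>0 :: "real ^ 'n option \<Rightarrow> real"
    and m\<^sub>Y :: "real ^ 'n \<Rightarrow> real" and \<sigma>\<^sub>2\<^sub>2\<^sub>1 :: real
    and N :: "real measure" and G\<^sub>0 :: "real \<Rightarrow> real"
    and h :: "real ^ 'n \<Rightarrow> real" and w\<^sub>0 :: "real \<Rightarrow> real"
    and w :: "real ^ 'n \<Rightarrow> real \<Rightarrow> real"
    and f :: "real ^ 'n option \<Rightarrow> real"
  assumes "prob_space M"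
    and "elliptically_contoured M (\<lambda>\<omega>. block_vec (X \<omega>) (Y \<omega>))
           (block_vec \<mu>\<^sub>x \<mu>\<^sub>y) (block_matrix \<Sigma>\<^sub>1\<^sub>1 \<sigma>\<^sub>1\<^sub>2 \<sigma>\<^sub>2\<^sub>1 \<sigma>\<^sub>2\<^sub>2) \<psi>"
    and "\<And>z. f\<^sub>0 z \<ge> 0"
    and "distributed M lborel (\<lambda>\<omega>. block_vec (X \<omega>) (Y \<omega>)) (\<lambda>z. ennreal (f\<^sub>0 z))"
    and "\<And>x. m\<^sub>Y x = \<mu>\<^sub>y + \<sigma>\<^sub>2\<^sub>1 \<bullet> (matrix_inv \<Sigma>\<^sub>1\<^sub>1 *v (x - \<mu>\<^sub>x))"
    and "\<sigma>\<^sub>2\<^sub>2\<^sub>1 = \<sigma>\<^sub>2\<^sub>2 - \<sigma>\<^sub>2\<^sub>1 \<bullet> (matrix_inv \<Sigma>\<^sub>1\<^sub>1 *v \<sigma>\<^sub>1\<^sub>2)"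
    and "real_distribution N" and "G\<^sub>0 = cdf N"
    and "continuous_on UNIV G\<^sub>0"
    and "\<And>t. G\<^sub>0 (- t) = 1 - G\<^sub>0 t"
    and "h \<in> borel_measurable borel"
    and "w\<^sub>0 \<in> borel_measurable borel" and "\<And>u. w\<^sub>0 (- u) = - w\<^sub>0 u"
    and "(\<forall>x y. w x y = w\<^sub>0 (y - m\<^sub>Y x) * h x) \<or>
         (\<forall>x y. w x y = w\<^sub>0 ((y - m\<^sub>Y x) / sqrt \<sigma>\<^sub>2\<^sub>2\<^sub>1) * h x)"
    and "\<And>x y. f (block_vec x y) = 2 * f\<^sub>0 (block_vec x y) * G\<^sub>0 (w x y)"
  shows "(\<forall>z. f z \<ge> 0) \<and> integrable lborel f \<and> (\<integral>z. f z \<partial>lborel) = 1"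
proof -
  interpret prob_space M by fact
  interpret N: real_distribution N by fact
  let ?Z = "\<lambda>\<omega>. block_vec (X \<omega>) (Y \<omega>)"
  define P where "P = distr M borel ?Z"
  have Z [measurable]: "?Z \<in> borel_measurable M"
    using assms(2) by (simp add: elliptically_contoured_def)
  interpret P: prob_space P
    unfolding P_def by (rule prob_space_distr) fact
  have [measurable_cong]: "sets P = sets borel"
    by (simp add: P_def)
  \<comment> \<open>\<open>P\<close> is used in two ways: as a law for the invariance, and as a
    density to pass to Lebesgue measure.\<close>
  have P_density: "P = density lborel (\<lambda>z. ennreal (f\<^sub>0 z))"
    using distributed_distr_eq_density[OF assms(4)] by (simp add: P_def cong: distr_cong)
  have [measurable]: "f\<^sub>0 \<in> borel_measurable borel"
  proof -
    have [measurable]: "(\<lambda>z. ennreal (f\<^sub>0 z)) \<in> borel_measurable borel"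
      using distributed_borel_measurable[OF assms(4)] by simp
    \<comment> \<open>\<open>distributed\<close> yields measurability only of the
      \<open>ennreal\<close>-valued density; nonnegativity of \<open>f\<^sub>0\<close> allows going
      back to the reals.\<close>
    have "(\<lambda>z. enn2real (ennreal (f\<^sub>0 z))) \<in> borel_measurable borel"
      by measurable
    then show ?thesis using assms(3) by simp
  qed
  have m_cont: "continuous_on UNIV m\<^sub>Y"
    unfolding assms(5)
    by (intro continuous_intros continuous_on_compose2[OF matrix_vector_mult_linear_continuous_on]) auto
  define v where "v z = w (block_fst z) (z $ None)" for z
  have v_odd: "v (block_reflect m\<^sub>Y z) = - v z" for z
  proof -
    \<comment> \<open>The reflection replaces \<open>y - m\<^sub>Y x\<close> by its negative;
      dividing by the scale preserves this sign change, so both forms of \<open>w\<close> are odd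
      along it.\<close>
    have "w x (2 * m\<^sub>Y x - y) = - w x y" for x y
      using assms(14)
    proof
      assume "\<forall>x y. w x y = w\<^sub>0 (y - m\<^sub>Y x) * h x"
      then show ?thesis using assms(13)[of "y - m\<^sub>Y x"] by simp
    next
      assume "\<forall>x y. w x y = w\<^sub>0 ((y - m\<^sub>Y x) / sqrt \<sigma>\<^sub>2\<^sub>2\<^sub>1) * h x"
      moreover have "(2 * m\<^sub>Y x - y - m\<^sub>Y x) / sqrt \<sigma>\<^sub>2\<^sub>2\<^sub>1 = - ((y - m\<^sub>Y x) / sqrt \<sigma>\<^sub>2\<^sub>2\<^sub>1)"
        by (simp add: minus_divide_left)
      ultimately show ?thesis using assms(13) by simp
    qed
    then show ?thesis by (simp add: v_def block_reflect_def)
  qed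
  have [measurable]: "v \<in> borel_measurable borel"
  proof -
    note [measurable] = assms(11,12) borel_measurable_continuous_onI[OF m_cont]
      borel_measurable_continuous_onI[OF continuous_on_block_fst]
    have [measurable]: "(\<lambda>z::real ^ 'n option. z $ None) \<in> borel_measurable borel"
      by (intro borel_measurable_continuous_onI continuous_intros)
    from assms(14) show ?thesis
      by (rule disjE) (simp_all add: v_def[abs_def])
  qed
  have [measurable]: "block_reflect m\<^sub>Y \<in> borel_measurable borel"
    using m_cont by (rule borel_measurable_block_reflect)
  have "distr P P (block_reflect m\<^sub>Y) = P"
    using distr_block_reflect[OF assms(1,2,5) m_cont]
    by (simp add: P_def cong: distr_cong)
  \<comment> \<open>The two placeholders are the measurability premises, discharged where
    \<open>skew\<close> is used.\<close>
  note skew = integral_skewing_factor[where P = P and R = "block_reflect m\<^sub>Y" and v = v,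
      OF P.prob_space_axioms _ _ this v_odd assms(7)
      assms(10)[unfolded assms(8)]]
  have [measurable]: "cdf N \<in> borel_measurable borel"
    by (intro borel_measurable_mono monoI N.cdf_nondecreasing)
  \<comment> \<open>The product is written with \<open>*\<^sub>R\<close> to match the rules for
    integrals against a density.\<close>
  have f: "f z = f\<^sub>0 z *\<^sub>R (2 * cdf N (v z))" for z
    using assms(15)[of "block_fst z" "z $ None"] by (simp add: v_def assms(8))
  have int: "integrable P (\<lambda>z. 2 * cdf N (v z))" "(\<integral>z. 2 * cdf N (v z) \<partial>P) = 1"
    using skew by simp_all
  have f_eq: "f = (\<lambda>z. f\<^sub>0 z *\<^sub>R (2 * cdf N (v z)))"
    using f by blast
  have "integrable lborel f"
    using int(1) assms(3) unfolding P_density f_eq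
    by (subst (asm) integrable_density) auto
  moreover have "integral\<^sup>L lborel f = 1"
    using int(2) assms(3) unfolding P_density f_eq
    by (subst (asm) integral_density) auto
  moreover have "f z \<ge> 0" for z
    by (simp add: f assms(3) N.cdf_nonneg)
  ultimately show ?thesis by blast
qed

end
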